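(* Let $k\ge 2$, $d\ge 2$ and $r\ge 1$ be integers. If $\lambda$ is a root of $G^{k,d}_{r+1}$, then $\lambda$ is an eigenvalue of the upper adjacency operator of the $k$-ary rooted fan of dimension $d$ and depth $r$.
   Context: The polynomials $F^{k,d}_n(x)$ are defined by $F^{k,d}_0(x)=0$, $F^{k,d}_1(x)=1$, and $F^{k,d}_{n+1}(x)=(x-(d-2))F^{k,d}_n(x)-k(d-1)F^{k,d}_{n-1}(x)$ for $n\ge1$; and $G^{k,d}_n(x)=xF^{k,d}_n(x)-k(d-1)F^{k,d}_{n-1}(x)$ for $n\ge 1$. The $k$-ary rooted fan is a simplicial complex built from a single root simplex by repeatedly attaching $k$ new simplices of one dimension higher along each codimension-one face added at the previous step; in the indexing used here each attached simplex has $d$ codimension-one faces, so each attachment adds $d-1$ new ones (for $d=2$ one recovers the $k$-ary rooted tree, for $d=3$ triangles are glued along edges). Its upper adjacency graph has as vertices the codimension-one simplices, two being adjacent if and only if they bound a common top-dimensional simplex. Explicitly, the upper adjacency graph of the fan of depth $r$ is the graph obtained from a single root node by performing $r$ steps, where at each step, for every node $u$ added at the previous step (at the first step, for the root), one adds $k$ new disjoint copies of the complete graph on $d-1$ nodes and joins every node of these copies to $u$. The upper adjacency operator is the adjacency operator of this graph. *)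

theory Defs
  imports Complex_Main "HOL-Computational_Algebra.Polynomial"
begin

fun F_poly :: "nat \<Rightarrow> nat \<Rightarrow> nat \<Rightarrow> complex poly" where
  "F_poly k d 0 = 0"
| "F_poly k d (Suc 0) = 1"
| "F_poly k d (Suc (Suc n)) =
     ([:0, 1:] - [:of_nat d - 2:]) * F_poly k d (Suc n)
     - smult (of_nat k * (of_nat d - 1)) (F_poly k d n)"

(* Only meaningful for n >= 1, since n - 1 truncates at n = 0. *)
definition G_poly :: "nat \<Rightarrow> nat \<Rightarrow> nat \<Rightarrow> complex poly" where
  "G_poly k d n =
     [:0, 1:] * F_poly k d n - smult (of_nat k * (of_nat d - 1)) (F_poly k d (n - 1))"

(* A node records how it was attached: [] is the root, and (i, j) # u is the j-th node of the
   i-th copy of the complete graph on d - 1 nodes attached to u. Distinct labels keep the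
   copies disjoint. *)
type_synonym fan_node = "(nat \<times> nat) list"

primrec fan_layer :: "nat \<Rightarrow> nat \<Rightarrow> nat \<Rightarrow> fan_node set" where
  "fan_layer k d 0 = {[]}"
| "fan_layer k d (Suc s) = {(i, j) # u | i j u. u \<in> fan_layer k d s \<and> i < k \<and> j < d - 1}"

primrec fan_nodes :: "nat \<Rightarrow> nat \<Rightarrow> nat \<Rightarrow> fan_node set" where
  "fan_nodes k d 0 = {[]}"
| "fan_nodes k d (Suc s) = fan_nodes k d s \<union> fan_layer k d (Suc s)"

(* Step s + 1 adds the edges inside each new copy and those joining it to its parent u. *)
primrec fan_edges :: "nat \<Rightarrow> nat \<Rightarrow> nat \<Rightarrow> fan_node set set" where
  "fan_edges k d 0 = {}"
| "fan_edges k d (Suc s) = fan_edges k d s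
     \<union> {{(i, j) # u, (i, j') # u} | i j j' u.
          u \<in> fan_layer k d s \<and> i < k \<and> j < d - 1 \<and> j' < d - 1 \<and> j \<noteq> j'}
     \<union> {{u, (i, j) # u} | i j u. u \<in> fan_layer k d s \<and> i < k \<and> j < d - 1}"

lemma finite_fan_layer: "finite (fan_layer k d s)"
proof (induction s)
  case (Suc s)
  have "fan_layer k d (Suc s) = (\<lambda>((i, j), u). (i, j) # u) ` (({..<k} \<times> {..<d - 1}) \<times> fan_layer k d s)"
    by (auto simp: image_iff)
  then show ?case
    using Suc by simp
qed simp

(* Ensures that the sums over neighbours in the adjacency operator are genuine finite sums. *)
lemma finite_fan_nodes: "finite (fan_nodes k d r)"
  by (induction r) (simp_all add: finite_fan_layer del: fan_layer.simps)

lemma fan_layer_subset_nodes: "fan_layer k d s \<subseteq> fan_nodes k d s"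
  by (cases s) auto

lemma fan_edges_simple:
  "e \<in> fan_edges k d r \<Longrightarrow> e \<subseteq> fan_nodes k d r \<and> card e = 2"
proof (induction r)
  case (Suc r)
  then show ?case
    using fan_layer_subset_nodes[of k d r] by (auto simp: card_insert_if)
qed simp

(* Complex-valued functions on the finite vertex set V, as functions vanishing outside V. *)
definition functions_on :: "'v set \<Rightarrow> ('v \<Rightarrow> complex) set" where
  "functions_on V = {f. \<forall>u. u \<notin> V \<longrightarrow> f u = 0}"

definition adjacency_operator ::
    "'v set \<Rightarrow> 'v set set \<Rightarrow> ('v \<Rightarrow> complex) \<Rightarrow> 'v \<Rightarrow> complex" where
  "adjacency_operator V E f = (\<lambda>u. if u \<in> V then \<Sum>v | v \<in> V \<and> {u, v} \<in> E. f v else 0)"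

definition is_eigenvalue ::
    "'v set \<Rightarrow> (('v \<Rightarrow> complex) \<Rightarrow> 'v \<Rightarrow> complex) \<Rightarrow> complex \<Rightarrow> bool" where
  "is_eigenvalue V T \<mu> \<longleftrightarrow>
     (\<exists>f \<in> functions_on V. f \<noteq> (\<lambda>_. 0) \<and> T f = (\<lambda>u. \<mu> * f u))"

definition fan_upper_adjacency ::
    "nat \<Rightarrow> nat \<Rightarrow> nat \<Rightarrow> (fan_node \<Rightarrow> complex) \<Rightarrow> fan_node \<Rightarrow> complex" where
  "fan_upper_adjacency k d r = adjacency_operator (fan_nodes k d r) (fan_edges k d r)"

end

(* The eigenfunction is radial. Solving the eigenvalue equation from the leaves upwards forces
   the value F_(r+1-s)(mu) at depth s: the node itself has one parent, d - 2 siblings in its clique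
   and k (d - 1) children, so the equation at depth s >= 1 is the recurrence for F, and the
   missing children of the leaves correspond to F_0 = 0. What remains is the equation at the root,
   which is G_(r+1)(mu) = 0. The function does not vanish because it is F_1 = 1 on the leaves. *)

theory Submission
  imports Defs
begin

lemma mem_fan_layer_iff:
  "u \<in> fan_layer k d s \<longleftrightarrow> length u = s \<and> set u \<subseteq> {..<k} \<times> {..<d - 1}"
proof (induction s arbitrary: u)
  case (Suc s)
  then show ?case
    by (cases u) auto
qed auto

lemma mem_fan_nodes_iff:
  "u \<in> fan_nodes k d r \<longleftrightarrow> length u \<le> r \<and> set u \<subseteq> {..<k} \<times> {..<d - 1}"
  by (induction r) (auto simp: mem_fan_layer_iff le_Suc_eq simp del: fan_layer.simps)

text \<open>The three cases are child, parent and clique sibling; \<open>fst (hd u)\<close> is the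
  index of the copy. No parameter occurs, so one relation serves all steps of the
  construction.\<close>

definition fan_adjacent :: "fan_node \<Rightarrow> fan_node \<Rightarrow> bool" where
  "fan_adjacent u v \<longleftrightarrow>
    (u \<noteq> [] \<and> tl u = v) \<or> (v \<noteq> [] \<and> tl v = u) \<or>
    (u \<noteq> [] \<and> v \<noteq> [] \<and> u \<noteq> v \<and> tl u = tl v \<and> fst (hd u) = fst (hd v))"

lemma mem_sibling_edges_iff:
  "{u, v} \<in> {{(i, j) # w, (i, j') # w} | i j j' w.
      w \<in> fan_layer k d s \<and> i < k \<and> j < d - 1 \<and> j' < d - 1 \<and> j \<noteq> j'} \<longleftrightarrow>
    u \<in> fan_layer k d (Suc s) \<and> v \<in> fan_layer k d (Suc s) \<and> u \<noteq> v \<and> tl u = tl v \<and>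
    fst (hd u) = fst (hd v)"
  by (auto simp: doubleton_eq_iff) blast+

lemma mem_parent_edges_iff:
  "{u, v} \<in> {{w, (i, j) # w} | i j w. w \<in> fan_layer k d s \<and> i < k \<and> j < d - 1} \<longleftrightarrow>
    u \<in> fan_layer k d (Suc s) \<and> tl u = v \<or> v \<in> fan_layer k d (Suc s) \<and> tl v = u"
  by (auto simp: doubleton_eq_iff) blast+

text \<open>The fan is the subgraph of \<open>fan_adjacent\<close> induced on its nodes. A node of
  the newest layer has no children yet, so its only neighbours are its parent and its siblings,
  which are exactly the edges added in that step.\<close>

lemma mem_fan_edges_iff:
  "{u, v} \<in> fan_edges k d r \<longleftrightarrow> u \<in> fan_nodes k d r \<and> v \<in> fan_nodes k d r \<and> fan_adjacent u v"
proof (induction r)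
  case 0
  show ?case
    by (auto simp: fan_adjacent_def)
next
  case (Suc r)
  show ?case
    unfolding fan_edges.simps Un_iff Suc.IH mem_sibling_edges_iff mem_parent_edges_iff
    unfolding mem_fan_layer_iff mem_fan_nodes_iff fan_adjacent_def
    by (cases u; cases v) (auto simp: le_Suc_eq)
qed

definition fan_children :: "nat \<Rightarrow> nat \<Rightarrow> fan_node \<Rightarrow> fan_node set" where
  "fan_children k d u = (\<lambda>p. p # u) ` ({..<k} \<times> {..<d - 1})"

definition fan_siblings :: "nat \<Rightarrow> nat \<Rightarrow> nat \<Rightarrow> fan_node \<Rightarrow> fan_node set" where
  "fan_siblings d i j w = (\<lambda>j'. (i, j') # w) ` ({..<d - 1} - {j})"

lemma fan_neighbours_root:
  assumes "r \<ge> 1"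
  shows "{v. v \<in> fan_nodes k d r \<and> {[], v} \<in> fan_edges k d r} = fan_children k d []"
  using assms
  by (auto simp: mem_fan_nodes_iff mem_fan_edges_iff fan_adjacent_def fan_children_def neq_Nil_conv)

lemma fan_neighbours_Cons:
  assumes "(i, j) # w \<in> fan_nodes k d r"
  shows "{v. v \<in> fan_nodes k d r \<and> {(i, j) # w, v} \<in> fan_edges k d r} =
    insert w (fan_siblings d i j w \<union>
      (if Suc (length w) < r then fan_children k d ((i, j) # w) else {}))"
  using assms
  by (auto simp: mem_fan_nodes_iff mem_fan_edges_iff fan_adjacent_def fan_children_def
      fan_siblings_def neq_Nil_conv)

lemma sum_fan_children:
  "(\<Sum>v\<in>fan_children k d u. g (length v)) = of_nat (k * (d - 1)) * (g (Suc (length u)) :: complex)"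
  unfolding fan_children_def by (subst sum.reindex) (auto simp: inj_on_def)

text \<open>Since \<open>j\<close> is in range, removing it from the d - 1 indices leaves d -
  2.\<close>

lemma sum_fan_siblings:
  assumes "j < d - 1"
  shows "(\<Sum>v\<in>fan_siblings d i j w. g (length v)) = of_nat (d - 2) * (g (Suc (length w)) :: complex)"
  unfolding fan_siblings_def using assms
  by (subst sum.reindex) (auto simp: inj_on_def numeral_2_eq_2)

lemma sum_fan_neighbours_Cons:
  fixes g :: "nat \<Rightarrow> complex"
  assumes "(i, j) # w \<in> fan_nodes k d r"
  shows "(\<Sum>v | v \<in> fan_nodes k d r \<and> {(i, j) # w, v} \<in> fan_edges k d r. g (length v)) =
    g (length w) + of_nat (d - 2) * g (Suc (length w)) +
    (if Suc (length w) < r then of_nat (k * (d - 1)) * g (Suc (Suc (length w))) else 0)"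
proof -
  let ?C = "if Suc (length w) < r then fan_children k d ((i, j) # w) else {}"
  have fin: "finite (fan_siblings d i j w)" "finite ?C"
    by (simp_all add: fan_siblings_def fan_children_def)
  \<comment> \<open>Parent, siblings and children lie at three different depths, so their lengths
    separate them.\<close>
  have disj: "w \<notin> fan_siblings d i j w \<union> ?C" "fan_siblings d i j w \<inter> ?C = {}"
    by (auto simp: fan_siblings_def fan_children_def dest: arg_cong[of _ _ length])
  have j: "j < d - 1"
    using assms by (simp add: mem_fan_nodes_iff)
  show ?thesis
    unfolding fan_neighbours_Cons[OF assms]
    using fin disj sum_fan_siblings[OF j, of g i w] sum_fan_children[of g k d "(i, j) # w"]
    by (simp add: sum.union_disjoint)
qed

lemma poly_F_poly_rec:
  "poly (F_poly k d (Suc (Suc n))) \<mu> =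
    (\<mu> - (of_nat d - 2)) * poly (F_poly k d (Suc n)) \<mu>
      - of_nat k * (of_nat d - 1) * poly (F_poly k d n) \<mu>"
  by (simp add: algebra_simps)

theorem theorem12:
  fixes k d r :: nat and \<mu> :: complex
  assumes "k \<ge> 2" and "d \<ge> 2" and "r \<ge> 1"
    and "poly (G_poly k d (r + 1)) \<mu> = 0"
  shows "is_eigenvalue (fan_nodes k d r) (fan_upper_adjacency k d r) \<mu>"
proof -
  let ?V = "fan_nodes k d r" and ?E = "fan_edges k d r"
  define g where "g s = poly (F_poly k d (Suc r - s)) \<mu>" for s
  define f where "f u = (if u \<in> ?V then g (length u) else 0)" for u
  \<comment> \<open>As d \<ge> 2, the truncated subtractions that count neighbours agree with those
    in the coefficients of the recurrence.\<close>
  have K: "of_nat (k * (d - 1)) = of_nat k * (of_nat d - 1 :: complex)"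
    "of_nat (d - 2) = (of_nat d - 2 :: complex)"
    using assms(2) by (simp_all add: of_nat_diff)
  have root: "of_nat (k * (d - 1)) * g 1 = \<mu> * g 0"
    using assms(4) unfolding K g_def G_poly_def by simp
  \<comment> \<open>This is the equation at a node of depth \<open>Suc s\<close>, indexed by the
    depth of its parent.\<close>
  have rec: "g s + of_nat (d - 2) * g (Suc s) +
      (if Suc s < r then of_nat (k * (d - 1)) * g (Suc (Suc s)) else 0) = \<mu> * g (Suc s)"
    if "s < r" for s
  proof -
    \<comment> \<open>Here \<open>n\<close> counts the layers below depth \<open>Suc s\<close>. The
      values at depths \<open>s\<close>, \<open>Suc s\<close> and \<open>Suc (Suc s)\<close> then
      come from F with indices n + 2, n + 1 and n.\<close>
    obtain n where n: "r = Suc (s + n)"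
      using \<open>s < r\<close> less_imp_Suc_add by blast
    have "Suc r - s = Suc (Suc n)" "Suc r - Suc s = Suc n" "Suc r - Suc (Suc s) = n"
      using n by auto
    then have "g s = (\<mu> - (of_nat d - 2)) * g (Suc s) - of_nat k * (of_nat d - 1) * g (Suc (Suc s))"
      unfolding g_def by (simp only: poly_F_poly_rec)
    \<comment> \<open>At a leaf n = 0, so the child term of the recurrence vanishes and both
      branches of the conditional agree.\<close>
    moreover have "g (Suc (Suc s)) = 0" if "\<not> Suc s < r"
      using that n by (simp add: g_def)
    ultimately show ?thesis
      unfolding K by (auto simp: algebra_simps)
  qed
  have "(\<Sum>v | v \<in> ?V \<and> {u, v} \<in> ?E. g (length v)) = \<mu> * g (length u)" if u: "u \<in> ?V" for u
  proof (cases u)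
    case Nil
    then show ?thesis
      using root sum_fan_children[of g k d "[]"] by (simp add: fan_neighbours_root[OF assms(3)])
  next
    case (Cons p w)
    then obtain i j where uw: "u = (i, j) # w"
      by (cases p) auto
    then have "length w < r"
      using u by (simp add: mem_fan_nodes_iff)
    then show ?thesis
      using sum_fan_neighbours_Cons[of i j w k d r g] u rec[of "length w"] by (simp add: uw)
  qed
  then have "fan_upper_adjacency k d r f = (\<lambda>u. \<mu> * f u)"
    unfolding fan_upper_adjacency_def adjacency_operator_def f_def by auto
  \<comment> \<open>This list is a leaf: the label (0, 0) is admissible because k > 0 and d - 1 >
    0.\<close>
  moreover have "f (replicate r (0, 0)) = 1"
    using assms(1,2) by (simp add: f_def g_def mem_fan_nodes_iff set_replicate_conv_if)
  then have "f \<noteq> (\<lambda>_. 0)"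
    by (metis zero_neq_one)
  moreover have "f \<in> functions_on ?V"
    by (simp add: functions_on_def f_def)
  ultimately show ?thesis
    unfolding is_eigenvalue_def by blast
qed

end
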